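(* Let $A,B$ be two invertible positive operators on a Hilbert space $\mathscr{H}$ and let $h,h'$ be real numbers such that either $I<h'I\le A^{-\frac12}BA^{-\frac12}\le hI$ (so $1<h'\le h$) or $0<hI\le A^{-\frac12}BA^{-\frac12}\le h'I<I$ (so $0<h\le h'<1$). Let $p\in[0,1]$, $r=\min\{p,1-p\}$ and $R=\max\{p,1-p\}$. Then $$K^{r}(h',2)\,A\#_pB\;\le\;A\nabla_pB\;\le\;K^{R}(h,2)\,A\#_pB.$$
   Context: Operators are bounded linear operators on a Hilbert space $\mathscr{H}$, $I$ is the identity operator, and $X\le Y$ denotes the usual (Loewner) order on self-adjoint operators, i.e. $Y-X$ is positive (positive semidefinite). For invertible positive operators $A,B$ and $p\in[0,1]$: $A\#_pB:=A^{\frac12}\left(A^{-\frac12}BA^{-\frac12}\right)^{p}A^{\frac12}$ and $A\nabla_pB:=(1-p)A+pB$. For $x>0$, the Kantorovich constant is $K(x,2):=\dfrac{(x+1)^2}{4x}$, and $K^{s}(x,2)$ denotes the power $\big(K(x,2)\big)^s$. *)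

theory Defs
  imports "HOL-Analysis.Analysis" "HOL-Computational_Algebra.Polynomial"
begin

(* Complex Hilbert spaces.  The real inner product, and hence the norm and the
   topology, are those of the underlying real Hilbert space; cinner is linear in
   its first argument. *)
class chilbert_space = real_inner + complete_space +
  fixes scaleC :: "complex \<Rightarrow> 'a \<Rightarrow> 'a" (infixr \<open>*\<^sub>C\<close> 75)
    and cinner :: "'a \<Rightarrow> 'a \<Rightarrow> complex"
  assumes scaleR_scaleC: "r *\<^sub>R x = complex_of_real r *\<^sub>C x"
    and scaleC_add_right: "c *\<^sub>C (x + y) = c *\<^sub>C x + c *\<^sub>C y"
    and scaleC_add_left: "(c + d) *\<^sub>C x = c *\<^sub>C x + d *\<^sub>C x"
    and scaleC_scaleC: "c *\<^sub>C d *\<^sub>C x = (c * d) *\<^sub>C x"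
    and cinner_commute: "cinner x y = cnj (cinner y x)"
    and cinner_add_left: "cinner (x + y) z = cinner x z + cinner y z"
    and cinner_scaleC_left: "cinner (c *\<^sub>C x) y = c * cinner x y"
    and inner_eq_Re_cinner: "inner x y = Re (cinner x y)"

instantiation complex :: chilbert_space
begin

definition scaleC_complex :: "complex \<Rightarrow> complex \<Rightarrow> complex"
  where "scaleC_complex c x = c * x"

definition cinner_complex :: "complex \<Rightarrow> complex \<Rightarrow> complex"
  where "cinner_complex x y = x * cnj y"

instance
  by standard
    (auto simp: scaleC_complex_def cinner_complex_def scaleR_conv_of_real
      inner_complex_def algebra_simps)

end

(* Elements of the type of bounded real-linear maps represent bounded operators on
   the complex Hilbert space exactly when they are complex-linear. *)
definition complex_linear_op :: "('a::chilbert_space \<Rightarrow>\<^sub>L 'a) \<Rightarrow> bool"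
  where "complex_linear_op T \<longleftrightarrow> (\<forall>c x. T (c *\<^sub>C x) = c *\<^sub>C T x)"

definition selfadjoint_op :: "('a::chilbert_space \<Rightarrow>\<^sub>L 'a) \<Rightarrow> bool"
  where "selfadjoint_op T \<longleftrightarrow>
    complex_linear_op T \<and> (\<forall>x y. cinner (T x) y = cinner x (T y))"

definition positive_op :: "('a::chilbert_space \<Rightarrow>\<^sub>L 'a) \<Rightarrow> bool"
  where "positive_op T \<longleftrightarrow>
    complex_linear_op T \<and> (\<forall>x. cinner (T x) x \<in> \<real>\<^sub>\<ge>\<^sub>0)"

definition invertible_op :: "('a::chilbert_space \<Rightarrow>\<^sub>L 'a) \<Rightarrow> bool"
  where "invertible_op T \<longleftrightarrow>
    (\<exists>S. complex_linear_op S \<and> S o\<^sub>L T = id_blinfun \<and> T o\<^sub>L S = id_blinfun)"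

definition loewner_le :: "('a::chilbert_space \<Rightarrow>\<^sub>L 'a) \<Rightarrow> ('a \<Rightarrow>\<^sub>L 'a) \<Rightarrow> bool"
    (infix \<open>\<le>\<^sub>L\<close> 50)
  where "X \<le>\<^sub>L Y \<longleftrightarrow> selfadjoint_op X \<and> selfadjoint_op Y \<and> positive_op (Y - X)"

definition op_spectrum :: "('a::chilbert_space \<Rightarrow>\<^sub>L 'a) \<Rightarrow> complex set"
  where "op_spectrum T =
    {z. \<not> (\<exists>S. complex_linear_op S \<and>
            (\<forall>x. S (T x - z *\<^sub>C x) = x) \<and> (\<forall>x. T (S x) - z *\<^sub>C S x = x))}"

definition op_poly :: "real poly \<Rightarrow> ('a::chilbert_space \<Rightarrow>\<^sub>L 'a) \<Rightarrow> ('a \<Rightarrow>\<^sub>L 'a)"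
  where "op_poly P T =
    (\<Sum>i\<le>degree P. coeff P i *\<^sub>R (((\<lambda>S. T o\<^sub>L S) ^^ i) id_blinfun))"

(* The continuous functional calculus f(T), for T self-adjoint (so that the spectrum
   is real) and f continuous on the spectrum: the norm limit of P n (T) for any real
   polynomials P n converging to f uniformly on the spectrum.  Not meaningful
   outside this case. *)
definition fun_calc :: "(real \<Rightarrow> real) \<Rightarrow> ('a::chilbert_space \<Rightarrow>\<^sub>L 'a) \<Rightarrow> ('a \<Rightarrow>\<^sub>L 'a)"
  where "fun_calc f T =
    (THE X. \<forall>P :: nat \<Rightarrow> real poly.
       uniform_limit {t. complex_of_real t \<in> op_spectrum T} (\<lambda>n. poly (P n)) f sequentially
       \<longrightarrow> (\<lambda>n. op_poly (P n) T) \<longlonglongrightarrow> X)"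

(* Meant for T positive and invertible, where the spectrum lies in the positive reals,
   so that negative and zero exponents are covered as well. *)
definition op_powr :: "('a::chilbert_space \<Rightarrow>\<^sub>L 'a) \<Rightarrow> real \<Rightarrow> ('a \<Rightarrow>\<^sub>L 'a)"
  where "op_powr T s = fun_calc (\<lambda>t. t powr s) T"

definition geom_mean ::
    "real \<Rightarrow> ('a::chilbert_space \<Rightarrow>\<^sub>L 'a) \<Rightarrow> ('a \<Rightarrow>\<^sub>L 'a) \<Rightarrow> ('a \<Rightarrow>\<^sub>L 'a)"
  where "geom_mean p A B =
    op_powr A (1/2)
      o\<^sub>L op_powr (op_powr A (-1/2) o\<^sub>L B o\<^sub>L op_powr A (-1/2)) p
      o\<^sub>L op_powr A (1/2)"

definition arith_mean ::
    "real \<Rightarrow> ('a::chilbert_space \<Rightarrow>\<^sub>L 'a) \<Rightarrow> ('a \<Rightarrow>\<^sub>L 'a) \<Rightarrow> ('a \<Rightarrow>\<^sub>L 'a)"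
  where "arith_mean p A B = (1 - p) *\<^sub>R A + p *\<^sub>R B"

definition kantorovich :: "real \<Rightarrow> real"
  where "kantorovich x = (x + 1)\<^sup>2 / (4 * x)"

end

theory Submission
  imports Defs "HOL-Computational_Algebra.Fundamental_Theorem_Algebra"
begin

text \<open>Writing \<open>S\<close> for the square root of \<open>A\<close>, both means have the form \<open>S X S\<close>, with
  \<open>X = C\<^sup>p\<close> and \<open>X = (1 - p) I + p C\<close>. Since conjugation by \<open>S\<close> and the functional calculus
  of \<open>C\<close> are both monotone, the claim reduces to
  \<open>K(t)\<^sup>r t\<^sup>p \<le> 1 - p + p t \<le> K(t)\<^sup>R t\<^sup>p\<close> for \<open>t > 0\<close>, an instance of Young's inequality, and to
  the monotonicity of \<open>K\<close> on either side of \<open>1\<close>. Monotonicity of the calculus rests on the fact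
  that a real polynomial that is nonnegative on the real spectrum of a self-adjoint \<open>T\<close> is
  positive at \<open>T\<close>: if \<open>q(T)\<close> took a negative value, some \<open>q(T) - m\<close> with \<open>m < 0\<close> would not be
  invertible, although \<open>q - m\<close> has no zero on the spectrum.\<close>

text \<open>Makes the space of bounded operators complete in norm, so that the Cauchy sequence in
  \<open>fun_calc_approximation\<close> has a limit.\<close>

instance chilbert_space \<subseteq> banach ..

lemma blinfun_eq_iff: "S = T \<longleftrightarrow> (\<forall>x. blinfun_apply S x = blinfun_apply T x)"
  by (auto intro: blinfun_eqI)

section \<open>Self-adjoint and positive operators\<close>

lemma cinner_scaleC_right:
  fixes x y :: "'a::chilbert_space"
  shows "cinner x (c *\<^sub>C y) = cnj c * cinner x y"
  by (metis cinner_commute cinner_scaleC_left complex_cnj_mult)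

lemma cinner_add_right:
  fixes x y z :: "'a::chilbert_space"
  shows "cinner x (y + z) = cinner x y + cinner x z"
  by (metis cinner_commute cinner_add_left complex_cnj_add)

lemma cinner_conv_inner:
  fixes x y :: "'a::chilbert_space"
  shows "cinner x y = Complex (x \<bullet> y) (x \<bullet> (\<i> *\<^sub>C y))"
  by (simp add: inner_eq_Re_cinner cinner_scaleC_right complex_eq_iff)

text \<open>By complex linearity, real symmetry tested at \<open>\<i> *\<^sub>C y\<close> yields the
  imaginary part of the complex identity. From here on the real inner product mostly
  suffices.\<close>

lemma selfadjoint_op_iff:
  "selfadjoint_op T \<longleftrightarrow> complex_linear_op T \<and> (\<forall>x y. T x \<bullet> y = x \<bullet> T y)"
proof -
  have "cinner (T x) y = cinner x (T y)"
    if "complex_linear_op T" "\<And>x y. T x \<bullet> y = x \<bullet> T y" for x y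
    using that by (simp add: cinner_conv_inner complex_linear_op_def)
  then show ?thesis
    unfolding selfadjoint_op_def by (metis inner_eq_Re_cinner)
qed

lemma selfadjoint_opD:
  assumes "selfadjoint_op T"
  shows "complex_linear_op T" "T x \<bullet> y = x \<bullet> T y"
  using assms by (auto simp: selfadjoint_op_iff)

lemma positive_op_selfadjoint:
  fixes T :: "'a::chilbert_space \<Rightarrow>\<^sub>L 'a"
  assumes "positive_op T"
  shows "selfadjoint_op T"
proof -
  have lin: "complex_linear_op T" and real: "Im (cinner (T x) x) = 0" for x
    using assms by (auto simp: positive_op_def complex_nonneg_Reals_iff)
  have "T x \<bullet> y = x \<bullet> T y" for x y
  proof -
    \<comment> \<open>Polarization: the diagonal terms are real, and the mixed terms contribute the
      difference of \<open>Re (cinner (T y) x)\<close> and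
      \<open>Re (cinner (T x) y)\<close>.\<close>
    have "Im (cinner (T (x + \<i> *\<^sub>C y)) (x + \<i> *\<^sub>C y)) = 0"
      by (rule real)
    then have "Re (cinner (T y) x) = Re (cinner (T x) y)"
      using real[of x] real[of y] lin
      by (simp add: blinfun.add_right complex_linear_op_def cinner_add_left cinner_add_right
          cinner_scaleC_left cinner_scaleC_right)
    then show ?thesis
      by (metis inner_eq_Re_cinner inner_commute)
  qed
  with lin show ?thesis
    by (simp add: selfadjoint_op_iff)
qed

lemma positive_op_iff:
  "positive_op T \<longleftrightarrow> selfadjoint_op T \<and> (\<forall>x. 0 \<le> T x \<bullet> x)"
proof
  assume "positive_op T"
  then show "selfadjoint_op T \<and> (\<forall>x. 0 \<le> T x \<bullet> x)"
    by (auto simp: positive_op_selfadjoint)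
      (auto simp: positive_op_def complex_nonneg_Reals_iff inner_eq_Re_cinner)
next
  assume *: "selfadjoint_op T \<and> (\<forall>x. 0 \<le> T x \<bullet> x)"
  have "Im (cinner (T x) x) = 0" for x
  proof -
    have "cinner (T x) x = cnj (cinner (T x) x)"
      using * by (metis selfadjoint_op_def cinner_commute)
    then show ?thesis
      by (metis Reals_cnj_iff complex_is_Real_iff)
  qed
  with * show "positive_op T"
    by (auto simp: positive_op_def selfadjoint_op_def complex_nonneg_Reals_iff inner_eq_Re_cinner)
qed

lemma complex_linear_op_intros:
  fixes S T :: "'a::chilbert_space \<Rightarrow>\<^sub>L 'a"
  shows "complex_linear_op id_blinfun"
    and "complex_linear_op S \<Longrightarrow> complex_linear_op T \<Longrightarrow> complex_linear_op (S + T)"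
    and "complex_linear_op S \<Longrightarrow> complex_linear_op T \<Longrightarrow> complex_linear_op (S - T)"
    and "complex_linear_op S \<Longrightarrow> complex_linear_op T \<Longrightarrow> complex_linear_op (S o\<^sub>L T)"
    and "complex_linear_op T \<Longrightarrow> complex_linear_op (c *\<^sub>R T)"
proof -
  have "d *\<^sub>C (x - y) = d *\<^sub>C x - d *\<^sub>C y" for d and x y :: 'a
    by (metis add_diff_cancel diff_add_cancel scaleC_add_right)
  then show "complex_linear_op S \<Longrightarrow> complex_linear_op T \<Longrightarrow> complex_linear_op (S - T)"
    by (simp add: complex_linear_op_def blinfun.diff_left)
qed (auto simp: complex_linear_op_def blinfun.bilinear_simps scaleC_add_right
    scaleR_scaleC scaleC_scaleC mult.commute)

lemma selfadjoint_op_intros: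
  fixes S T :: "'a::chilbert_space \<Rightarrow>\<^sub>L 'a"
  shows "selfadjoint_op id_blinfun"
    and "selfadjoint_op S \<Longrightarrow> selfadjoint_op T \<Longrightarrow> selfadjoint_op (S + T)"
    and "selfadjoint_op S \<Longrightarrow> selfadjoint_op T \<Longrightarrow> selfadjoint_op (S - T)"
    and "selfadjoint_op T \<Longrightarrow> selfadjoint_op (c *\<^sub>R T)"
    and "selfadjoint_op S \<Longrightarrow> selfadjoint_op T \<Longrightarrow> S o\<^sub>L T = T o\<^sub>L S \<Longrightarrow> selfadjoint_op (S o\<^sub>L T)"
    and "selfadjoint_op S \<Longrightarrow> selfadjoint_op T \<Longrightarrow> selfadjoint_op (S o\<^sub>L T o\<^sub>L S)"
proof -
  assume "selfadjoint_op S" "selfadjoint_op T" "S o\<^sub>L T = T o\<^sub>L S"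
  then show "selfadjoint_op (S o\<^sub>L T)"
    unfolding selfadjoint_op_iff
    by (metis blinfun_apply_blinfun_compose complex_linear_op_intros(4))
qed (auto simp: selfadjoint_op_iff complex_linear_op_intros blinfun.bilinear_simps
    inner_add_left inner_add_right inner_diff_left inner_diff_right)

lemma loewner_le_iff:
  "X \<le>\<^sub>L Y \<longleftrightarrow> selfadjoint_op X \<and> selfadjoint_op Y \<and> (\<forall>x. X x \<bullet> x \<le> Y x \<bullet> x)"
  by (auto simp: loewner_le_def positive_op_iff selfadjoint_op_intros blinfun.diff_left
      inner_diff_left)

text \<open>Carries inequalities between functions of \<open>C\<close> over to the means, with
  \<open>S\<close> the square root of \<open>A\<close>.\<close>

lemma loewner_le_conjugate:
  assumes "X \<le>\<^sub>L Y" and "selfadjoint_op S"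
  shows "S o\<^sub>L X o\<^sub>L S \<le>\<^sub>L S o\<^sub>L Y o\<^sub>L S"
proof -
  have "(S o\<^sub>L Z o\<^sub>L S) x \<bullet> x = Z (S x) \<bullet> S x" for Z x
    using assms(2) by (simp add: selfadjoint_opD)
  then show ?thesis
    using assms by (auto simp: loewner_le_iff selfadjoint_op_intros)
qed

lemma inner_blinfun_le:
  fixes T :: "'a::real_inner \<Rightarrow>\<^sub>L 'a"
  shows "\<bar>T x \<bullet> x\<bar> \<le> norm T * (x \<bullet> x)"
proof -
  have "\<bar>T x \<bullet> x\<bar> \<le> norm (T x) * norm x"
    by (rule Cauchy_Schwarz_ineq2)
  also have "\<dots> \<le> norm T * norm x * norm x"
    by (intro mult_right_mono norm_blinfun norm_ge_zero)
  finally show ?thesis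
    by (simp add: dot_square_norm power2_eq_square)
qed

section \<open>Invertibility and the bottom of the spectrum\<close>

lemma invertible_op_compose:
  assumes "invertible_op S" "invertible_op T"
  shows "invertible_op (S o\<^sub>L T)"
proof -
  obtain S' where S': "complex_linear_op S'" "S' o\<^sub>L S = id_blinfun" "S o\<^sub>L S' = id_blinfun"
    using assms(1) by (auto simp: invertible_op_def)
  obtain T' where T': "complex_linear_op T'" "T' o\<^sub>L T = id_blinfun" "T o\<^sub>L T' = id_blinfun"
    using assms(2) by (auto simp: invertible_op_def)
  have "S' (S x) = x" "S (S' x) = x" "T' (T x) = x" "T (T' x) = x" for x
    using S'(2,3) T'(2,3) by (auto simp: blinfun_eq_iff)
  then show ?thesis
    unfolding invertible_op_def
    by (intro exI[of _ "T' o\<^sub>L S'"])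
      (simp add: S' T' complex_linear_op_intros blinfun_eq_iff)
qed

lemma invertible_op_scaleR:
  assumes "invertible_op T" "c \<noteq> 0"
  shows "invertible_op (c *\<^sub>R T)"
proof -
  obtain S where S: "complex_linear_op S" "S o\<^sub>L T = id_blinfun" "T o\<^sub>L S = id_blinfun"
    using assms(1) by (auto simp: invertible_op_def)
  have "S (T x) = x" "T (S x) = x" for x
    using S(2,3) by (auto simp: blinfun_eq_iff)
  then show ?thesis
    unfolding invertible_op_def using assms(2)
    by (intro exI[of _ "(1 / c) *\<^sub>R S"])
      (simp add: S complex_linear_op_intros blinfun_eq_iff blinfun.bilinear_simps)
qed

lemma real_in_op_spectrum_iff:
  "complex_of_real t \<in> op_spectrum T \<longleftrightarrow> \<not> invertible_op (T - t *\<^sub>R id_blinfun)"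
  by (simp add: op_spectrum_def invertible_op_def blinfun_eq_iff blinfun.bilinear_simps
      flip: scaleR_scaleC)

text \<open>For small \<open>\<epsilon>\<close> the map \<open>x \<mapsto> x - \<epsilon> (T x - y)\<close> is a contraction whose fixed
  point solves \<open>T x = y\<close>.\<close>
lemma coercive_bij:
  fixes T :: "'a::chilbert_space \<Rightarrow>\<^sub>L 'a"
  assumes c: "c > 0" "\<And>x. c * (x \<bullet> x) \<le> T x \<bullet> x"
  shows "\<exists>!x. T x = y"
proof -
  \<comment> \<open>Adding \<open>c\<close> makes \<open>M\<close> positive and at least
    \<open>c\<close>, so the square root in \<open>q\<close> is real. The value of
    \<open>\<epsilon>\<close> minimises
    \<open>1 - 2 * \<epsilon> * c + \<epsilon>\<^sup>2 * M\<^sup>2\<close>, the bound on the squared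
    contraction factor.\<close>
  define M where "M = norm T + c"
  define \<epsilon> where "\<epsilon> = c / M\<^sup>2"
  define q where "q = sqrt (1 - (c / M)\<^sup>2)"
  have M: "M > 0" "c \<le> M" "norm T \<le> M"
    using c(1) by (auto simp: M_def add_nonneg_pos)
  have eps: "\<epsilon> > 0"
    using M c(1) by (simp add: \<epsilon>_def)
  have "(c / M)\<^sup>2 \<le> 1" "(c / M)\<^sup>2 > 0"
    using M c(1) by (auto simp: power_le_one)
  then have q: "0 \<le> q" "q < 1" "q\<^sup>2 = 1 - (c / M)\<^sup>2"
    by (auto simp: q_def)
  have contr: "norm (d - \<epsilon> *\<^sub>R T d) \<le> q * norm d" for d
  proof (rule power2_le_imp_le)
    have "norm (T d) \<le> M * norm d"
      by (meson M(3) norm_blinfun norm_ge_zero mult_right_mono order_trans)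
    then have "(norm (T d))\<^sup>2 \<le> M\<^sup>2 * (norm d)\<^sup>2"
      by (metis norm_ge_zero power_mono power_mult_distrib)
    then have 1: "\<epsilon>\<^sup>2 * (norm (T d))\<^sup>2 \<le> \<epsilon>\<^sup>2 * (M\<^sup>2 * (norm d)\<^sup>2)"
      by (intro mult_left_mono) auto
    have 2: "\<epsilon> * (c * (norm d)\<^sup>2) \<le> \<epsilon> * (T d \<bullet> d)"
      using c(2)[of d] eps by (intro mult_left_mono) (auto simp: dot_square_norm)
    have "(norm (d - \<epsilon> *\<^sub>R T d))\<^sup>2 = (norm d)\<^sup>2 - 2 * (\<epsilon> * (T d \<bullet> d)) + \<epsilon>\<^sup>2 * (norm (T d))\<^sup>2"
      unfolding power2_norm_eq_inner
      by (simp add: inner_diff_left inner_diff_right inner_commute power2_eq_square[of \<epsilon>]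
          algebra_simps)
    also have "\<dots> \<le> (norm d)\<^sup>2 - 2 * (\<epsilon> * (c * (norm d)\<^sup>2)) + \<epsilon>\<^sup>2 * (M\<^sup>2 * (norm d)\<^sup>2)"
      using 1 2 by linarith
    also have "\<dots> = (1 - (c / M)\<^sup>2) * (norm d)\<^sup>2"
      using M by (simp add: \<epsilon>_def field_simps power2_eq_square)
    finally show "(norm (d - \<epsilon> *\<^sub>R T d))\<^sup>2 \<le> (q * norm d)\<^sup>2"
      by (simp add: q power_mult_distrib)
  qed (simp add: q)
  have "\<exists>!x. x - \<epsilon> *\<^sub>R (T x - y) = x"
  proof (rule banach_fix_type)
    show "\<forall>x z. dist (x - \<epsilon> *\<^sub>R (T x - y)) (z - \<epsilon> *\<^sub>R (T z - y)) \<le> q * dist x z"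
    proof (intro allI)
      fix x z
      have "x - \<epsilon> *\<^sub>R (T x - y) - (z - \<epsilon> *\<^sub>R (T z - y)) = (x - z) - \<epsilon> *\<^sub>R T (x - z)"
        by (simp add: blinfun.diff_right algebra_simps)
      then show "dist (x - \<epsilon> *\<^sub>R (T x - y)) (z - \<epsilon> *\<^sub>R (T z - y)) \<le> q * dist x z"
        using contr[of "x - z"] by (simp only: dist_norm)
    qed
  qed (use q in auto)
  then show ?thesis
    using eps by simp
qed

text \<open>Coercivity at \<open>S y\<close> and the Cauchy-Schwarz inequality bound the inverse by
  \<open>1 / c\<close>; its linearity is inherited from \<open>T\<close> because \<open>T\<close> is
  bijective.\<close>

lemma coercive_invertible_op:
  fixes T :: "'a::chilbert_space \<Rightarrow>\<^sub>L 'a"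
  assumes lin: "complex_linear_op T" and c: "c > 0" "\<And>x. c * (x \<bullet> x) \<le> T x \<bullet> x"
  shows "invertible_op T"
proof -
  note ex1 = coercive_bij[OF c]
  define S where "S y = (THE x. T x = y)" for y
  have TS: "T (S y) = y" for y
    unfolding S_def by (rule theI'[OF ex1])
  have ST: "S (T x) = x" for x
    using ex1[of "T x"] TS[of "T x"] by auto
  have bound: "norm (S y) \<le> norm y * (1 / c)" for y
  proof -
    have "c * (norm (S y) * norm (S y)) \<le> y \<bullet> S y"
      using c(2)[of "S y"] by (simp add: TS dot_square_norm power2_eq_square)
    also have "\<dots> \<le> norm y * norm (S y)"
      by (rule norm_cauchy_schwarz)
    finally have "c * norm (S y) \<le> norm y"
      by (cases "S y = 0") auto
    then show ?thesis
      using c(1) by (simp add: field_simps)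
  qed
  have "bounded_linear S"
  proof (rule bounded_linear_intro)
    show "S (x + y) = S x + S y" for x y
      by (metis ST TS blinfun.add_right)
    show "S (r *\<^sub>R x) = r *\<^sub>R S x" for r x
      by (metis ST TS blinfun.scaleR_right)
  qed (rule bound)
  then have S: "blinfun_apply (Blinfun S) = S"
    by (rule bounded_linear_Blinfun_apply)
  have "S (d *\<^sub>C x) = d *\<^sub>C S x" for d x
    using lin by (metis ST TS complex_linear_op_def)
  then show ?thesis
    unfolding invertible_op_def
    by (intro exI[of _ "Blinfun S"]) (simp add: complex_linear_op_def S blinfun_eq_iff ST TS)
qed

text \<open>Positivity at \<open>x - s P x\<close>, for \<open>s\<close> the reciprocal of a bound on the norm of \<open>P\<close>,
  gives \<open>s \<parallel>P x\<parallel>\<^sup>2 \<le> \<langle>P x, x\<rangle>\<close>.\<close>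
lemma positive_invertible_coercive:
  fixes P :: "'a::chilbert_space \<Rightarrow>\<^sub>L 'a"
  assumes P: "positive_op P" and "invertible_op P"
  obtains c where "c > 0" "\<And>x. c * (x \<bullet> x) \<le> P x \<bullet> x"
proof -
  obtain V :: "'a \<Rightarrow>\<^sub>L 'a" where V: "V (P x) = x" for x
    using assms(2) by (auto simp: invertible_op_def blinfun_eq_iff)
  \<comment> \<open>The summand 1 keeps both bounds positive even on the zero space.\<close>
  define N where "N = norm P + 1"
  define K where "K = norm V + 1"
  have N: "N > 0" "norm P \<le> N" and K: "K > 0" "norm V \<le> K"
    by (auto simp: N_def K_def add_nonneg_pos)
  have *: "P x \<bullet> P x \<le> N * (P x \<bullet> x)" for x
  proof -
    define s where "s = 1 / N"
    have "P (P x) \<bullet> x = P x \<bullet> P x"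
      using P by (simp add: positive_op_iff selfadjoint_opD)
    moreover have "0 \<le> P (x - s *\<^sub>R P x) \<bullet> (x - s *\<^sub>R P x)"
      using P by (simp add: positive_op_iff)
    ultimately have "0 \<le> P x \<bullet> x - 2 * s * (P x \<bullet> P x) + s * s * (P (P x) \<bullet> P x)"
      by (simp add: blinfun.bilinear_simps inner_diff_left inner_diff_right algebra_simps)
    also have "s * s * (P (P x) \<bullet> P x) \<le> s * s * (N * (P x \<bullet> P x))"
    proof (rule mult_left_mono)
      have "P (P x) \<bullet> P x \<le> norm P * (P x \<bullet> P x)"
        using inner_blinfun_le[of P "P x"] by linarith
      also have "\<dots> \<le> N * (P x \<bullet> P x)"
        using N by (intro mult_right_mono) auto
      finally show "P (P x) \<bullet> P x \<le> N * (P x \<bullet> P x)" .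
    qed simp
    \<comment> \<open>Since \<open>s * N = 1\<close>, the last term cancels half of the middle
      one.\<close>
    finally have "s * (P x \<bullet> P x) \<le> P x \<bullet> x"
      using N by (simp add: s_def)
    then show ?thesis
      using N by (simp add: s_def field_simps)
  qed
  have "1 / (K\<^sup>2 * N) * (x \<bullet> x) \<le> P x \<bullet> x" for x
  proof -
    have "norm x \<le> K * norm (P x)"
      using norm_blinfun[of V "P x"] K(2)
      by (metis V norm_ge_zero mult_right_mono order_trans)
    then have "x \<bullet> x \<le> K\<^sup>2 * (P x \<bullet> P x)"
      by (metis norm_ge_zero power_mono power_mult_distrib power2_norm_eq_inner)
    also have "\<dots> \<le> K\<^sup>2 * (N * (P x \<bullet> x))"
      using * by (intro mult_left_mono) auto
    finally show ?thesis
      using N K by (simp add: field_simps)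
  qed
  moreover have "1 / (K\<^sup>2 * N) > 0"
    using N K by simp
  ultimately show ?thesis
    using that by blast
qed

text \<open>The infimum \<open>m\<close> of the numerical range works: \<open>S - m\<close> is
  positive, and if it were invertible, coercivity would raise the lower bound of the range from
  \<open>m\<close> to \<open>m + c\<close>.\<close>

lemma negative_value_negative_spectrum:
  fixes S :: "'a::chilbert_space \<Rightarrow>\<^sub>L 'a"
  assumes S: "selfadjoint_op S" and neg: "S x \<bullet> x < 0"
  obtains m where "m < 0" "complex_of_real m \<in> op_spectrum S"
proof -
  define W where "W = (\<lambda>y. S y \<bullet> y) ` {y. norm y = 1}"
  define m where "m = Inf W"
  have "- norm S \<le> S y \<bullet> y" if "norm y = 1" for y
    using inner_blinfun_le[of S y] that by (simp add: dot_square_norm)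
  then have bdd: "bdd_below W"
    by (auto simp: W_def intro!: bdd_belowI)
  define u where "u = (1 / norm x) *\<^sub>R x"
  have x: "x \<noteq> 0"
    using neg by auto
  then have u: "norm u = 1"
    by (simp add: u_def)
  have "S u \<bullet> u < 0"
    using neg x by (simp add: u_def blinfun.scaleR_right divide_neg_pos)
  moreover have "m \<le> S u \<bullet> u"
    unfolding m_def using u bdd by (intro cInf_lower) (auto simp: W_def)
  ultimately have "m < 0"
    by simp
  define P where "P = S - m *\<^sub>R id_blinfun"
  have "m * (y \<bullet> y) \<le> S y \<bullet> y" for y
  proof (cases "y = 0")
    case False
    then have "m \<le> S ((1 / norm y) *\<^sub>R y) \<bullet> ((1 / norm y) *\<^sub>R y)"
      unfolding m_def W_def[symmetric] using bdd False
      by (intro cInf_lower) (auto simp: W_def simp del: inner_scaleR_right)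
    also have "\<dots> = (S y \<bullet> y) / (y \<bullet> y)"
      by (simp add: blinfun.scaleR_right dot_square_norm power2_eq_square)
    finally show ?thesis
      using False by (simp add: field_simps)
  qed simp
  then have P: "positive_op P"
    using S by (simp add: P_def positive_op_iff selfadjoint_op_intros blinfun.bilinear_simps
        inner_diff_left)
  have "\<not> invertible_op P"
  proof
    assume "invertible_op P"
    with P obtain c where c: "c > 0" "\<And>y. c * (y \<bullet> y) \<le> P y \<bullet> y"
      by (metis positive_invertible_coercive)
    have "m + c \<le> m"
      unfolding m_def
    proof (rule cInf_greatest)
      show "W \<noteq> {}"
        using u by (auto simp: W_def)
      show "Inf W + c \<le> w" if w: "w \<in> W" for w
      proof -
        obtain y where y: "norm y = 1" "w = S y \<bullet> y"
          using w by (auto simp: W_def)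
        then show ?thesis
          using c(2)[of y]
          by (simp add: P_def m_def blinfun.bilinear_simps inner_diff_left dot_square_norm)
      qed
    qed
    with c(1) show False
      by simp
  qed
  then have "complex_of_real m \<in> op_spectrum S"
    by (simp add: real_in_op_spectrum_iff P_def)
  with \<open>m < 0\<close> show ?thesis
    by (rule that)
qed

text \<open>Subtracting a multiple \<open>M\<close> of the identity that exceeds the norm makes the
  form negative at \<open>x\<close>; the spectral point found for the difference is then shifted
  back by \<open>M\<close>.\<close>

lemma real_spectrum_nonempty:
  fixes T :: "'a::chilbert_space \<Rightarrow>\<^sub>L 'a" and x :: 'a
  assumes T: "selfadjoint_op T" and x: "x \<noteq> 0"
  obtains t where "complex_of_real t \<in> op_spectrum T"
proof -
  define M where "M = norm T + 1"
  have "T x \<bullet> x < M * (x \<bullet> x)"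
  proof -
    have "T x \<bullet> x \<le> norm T * (x \<bullet> x)"
      using inner_blinfun_le[of T x] by linarith
    also have "\<dots> < M * (x \<bullet> x)"
      using x by (simp add: M_def distrib_right)
    finally show ?thesis .
  qed
  then have "(T - M *\<^sub>R id_blinfun) x \<bullet> x < 0"
    by (simp add: blinfun.bilinear_simps inner_diff_left)
  then obtain m where "complex_of_real m \<in> op_spectrum (T - M *\<^sub>R id_blinfun)"
    using T by (metis negative_value_negative_spectrum selfadjoint_op_intros(1,3,4))
  then have "complex_of_real (M + m) \<in> op_spectrum T"
    unfolding real_in_op_spectrum_iff by (simp add: algebra_simps scaleR_add_left)
  then show ?thesis
    by (rule that)
qed

section \<open>Polynomials in a self-adjoint operator\<close>

lemma op_poly_0 [simp]: "op_poly 0 T = 0"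
  by (simp add: op_poly_def)

text \<open>Horner's scheme; it makes the algebraic identities below provable by induction on
  polynomials.\<close>

lemma op_poly_pCons [simp]:
  "op_poly (pCons a p) T = a *\<^sub>R id_blinfun + (T o\<^sub>L op_poly p T)"
proof (cases "p = 0")
  case True
  then show ?thesis
    by (simp add: op_poly_def)
next
  case False
  then show ?thesis
    by (simp add: op_poly_def sum.atMost_Suc_shift blinfun_eq_iff del: sum.atMost_Suc add: blinfun.bilinear_simps
        blinfun.sum_right blinfun.sum_left)
qed

lemma op_poly_add: "op_poly (p + q) T = op_poly p T + op_poly q T"
  by (induction p q rule: poly_induct2)
    (auto simp: blinfun_eq_iff blinfun.bilinear_simps scaleR_add_left)

lemma op_poly_smult: "op_poly (smult c p) T = c *\<^sub>R op_poly p T"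
  by (induction p) (auto simp: blinfun_eq_iff blinfun.bilinear_simps scaleR_add_right)

lemma op_poly_diff: "op_poly (p - q) T = op_poly p T - op_poly q T"
  using op_poly_add[of "p - q" q T] by simp

lemma op_poly_mult: "op_poly (p * q) T = op_poly p T o\<^sub>L op_poly q T"
  by (induction p)
    (auto simp: op_poly_add op_poly_smult blinfun_eq_iff blinfun.bilinear_simps)

lemma op_poly_const: "op_poly [:c:] T = c *\<^sub>R id_blinfun"
  by (simp add: blinfun_eq_iff blinfun.bilinear_simps)

lemma op_poly_X: "op_poly [:0, 1:] T = T"
  by (simp add: blinfun_eq_iff blinfun.bilinear_simps)

lemma op_poly_selfadjoint:
  assumes "selfadjoint_op T"
  shows "selfadjoint_op (op_poly p T)"
proof (induction p)
  case 0
  show ?case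
    by (simp add: selfadjoint_op_iff complex_linear_op_def)
      (metis diff_self blinfun.zero_left complex_linear_op_def complex_linear_op_intros(1,3))
next
  case (pCons a p)
  \<comment> \<open>Commuting factors are what makes a product of self-adjoint operators
    self-adjoint.\<close>
  have "T o\<^sub>L op_poly p T = op_poly p T o\<^sub>L T"
    using op_poly_mult[of "[:0, 1:]" p T] op_poly_mult[of p "[:0, 1:]" T]
    by (simp only: op_poly_X mult.commute[of p])
  then show ?case
    using assms pCons.IH by (simp add: selfadjoint_op_intros)
qed

text \<open>A complex root \<open>z\<close> exists by the fundamental theorem of algebra. If
  \<open>z\<close> is not real, the remainder of \<open>q\<close> modulo the real quadratic
  \<open>D\<close> with root \<open>z\<close> has degree at most 1 and vanishes at \<open>z\<close>,
  so it is zero.\<close>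

lemma real_poly_root_factor:
  fixes q :: "real poly"
  assumes "degree q > 0"
  obtains (linear) t q' where "q = [:- t, 1:] * q'"
    | (quadratic) u v q' where "q = [:u\<^sup>2 + v\<^sup>2, - 2 * u, 1:] * q'" "v \<noteq> 0"
proof -
  \<comment> \<open>Evaluation of a real polynomial at a complex point. Its additivity and
    multiplicativity allow the division by \<open>D\<close> to be evaluated at
    \<open>z\<close>.\<close>
  define ev where "ev p z = poly (map_poly complex_of_real p) z" for p z
  have ev_pCons: "ev (pCons a p) z = of_real a + z * ev p z" for a p z
    by (simp add: ev_def map_poly_pCons)
  have ev_0: "ev 0 z = 0" for z
    by (simp add: ev_def)
  have ev_add: "ev (p1 + p2) z = ev p1 z + ev p2 z" for p1 p2 z
    by (induction p1 p2 rule: poly_induct2) (auto simp: ev_pCons ev_0 algebra_simps)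
  have ev_smult: "ev (smult c p) z = of_real c * ev p z" for c p z
    by (induction p) (auto simp: ev_pCons ev_0 algebra_simps)
  have ev_mult: "ev (p1 * p2) z = ev p1 z * ev p2 z" for p1 p2 z
    by (induction p1) (auto simp: ev_pCons ev_0 ev_add ev_smult algebra_simps)
  have "degree (map_poly complex_of_real q) = degree q"
    by (rule degree_map_poly) simp
  then have "\<not> constant (poly (map_poly complex_of_real q))"
    using assms by (simp add: constant_degree)
  then obtain z where z: "ev q z = 0"
    using fundamental_theorem_of_algebra by (auto simp: ev_def)
  show ?thesis
  proof (cases "Im z = 0")
    case True
    then have "z = of_real (Re z)"
      by (simp add: complex_eq_iff)
    moreover have "ev q (of_real t) = of_real (poly q t)" for t
      by (induction q) (auto simp: ev_pCons ev_0)
    ultimately have "poly q (Re z) = 0"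
      by (metis z of_real_eq_0_iff)
    then have "[:- Re z, 1:] dvd q"
      by (simp add: poly_eq_0_iff_dvd)
    then show ?thesis
      using linear by (auto elim: dvdE)
  next
    case False
    define D where "D = [:(Re z)\<^sup>2 + (Im z)\<^sup>2, - 2 * Re z, 1:]"
    have evD: "ev D z = 0"
      by (simp add: D_def ev_pCons ev_0 complex_eq_iff power2_eq_square algebra_simps)
    have D: "D \<noteq> 0" "degree D = 2"
      by (auto simp: D_def)
    have "q = D * (q div D) + q mod D"
      by simp
    then have "ev q z = ev D z * ev (q div D) z + ev (q mod D) z"
      by (metis ev_add ev_mult)
    then have ev_mod: "ev (q mod D) z = 0"
      using evD z by simp
    have "degree (q mod D) < 2"
      using degree_mod_less'[of D q] D by (cases "q mod D = 0") auto
    then have "coeff (q mod D) (Suc (Suc n)) = 0" for n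
      by (simp add: coeff_eq_0)
    then obtain c d where cd: "q mod D = [:c, d:]"
      using that[of "coeff (q mod D) 0" "coeff (q mod D) 1"]
      by (simp add: poly_eq_iff coeff_pCons split: nat.split)
    then have "d = 0" "c = 0"
      using ev_mod False by (auto simp: ev_pCons ev_0 complex_eq_iff)
    then have "q = D * (q div D)"
      using cd \<open>q = D * (q div D) + q mod D\<close> by simp
    then show ?thesis
      using quadratic False D_def by blast
  qed
qed

text \<open>A non-real pair of conjugate roots \<open>u \<plusminus> \<i> v\<close> contributes the factor
  \<open>(T - u)\<^sup>2 + v\<^sup>2 \<ge> v\<^sup>2\<close>, so only the real spectrum matters.\<close>
lemma op_poly_invertible:
  fixes T :: "'a::chilbert_space \<Rightarrow>\<^sub>L 'a"
  assumes T: "selfadjoint_op T"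
    and "\<And>t. complex_of_real t \<in> op_spectrum T \<Longrightarrow> poly q t \<noteq> 0"
    and "q \<noteq> 0"
  shows "invertible_op (op_poly q T)"
  using assms(2,3)
proof (induction "degree q" arbitrary: q rule: less_induct)
  case less
  have id: "invertible_op (id_blinfun :: 'a \<Rightarrow>\<^sub>L 'a)"
    unfolding invertible_op_def
    by (rule exI[of _ id_blinfun]) (simp add: complex_linear_op_intros blinfun_eq_iff)
  show ?case
  proof (cases "degree q = 0")
    case True
    then obtain c where "q = [:c:]" "c \<noteq> 0"
      using less.prems(2) by (metis degree_eq_zeroE pCons_0_0)
    then show ?thesis
      using id by (metis op_poly_const invertible_op_scaleR)
  next
    case False
    then have "degree q > 0"
      by simp
    then show ?thesis
    proof (cases rule: real_poly_root_factor)
      case (linear t q')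
      then have q': "q' \<noteq> 0"
        using less.prems(2) by auto
      have "degree q = degree [:- t, 1:] + degree q'"
        unfolding linear by (rule degree_mult_eq) (use q' in auto)
      moreover have "complex_of_real t \<notin> op_spectrum T"
        using less.prems(1)[of t] by (auto simp: linear)
      then have "invertible_op (op_poly [:- t, 1:] T)"
        using op_poly_diff[of "[:0, 1:]" "[:t:]" T]
        by (simp add: real_in_op_spectrum_iff op_poly_X op_poly_const del: op_poly_pCons)
      moreover have "poly q' s \<noteq> 0" if "complex_of_real s \<in> op_spectrum T" for s
        using less.prems(1)[OF that] by (auto simp: linear)
      ultimately show ?thesis
        using less.hyps[of q'] q'
        by (simp add: linear op_poly_mult invertible_op_compose del: op_poly_pCons mult_pCons_left)
    next
      case (quadratic u v q')
      let ?D = "[:u\<^sup>2 + v\<^sup>2, - 2 * u, 1:]"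
      have q': "q' \<noteq> 0"
        using less.prems(2) quadratic by auto
      have "degree q = degree ?D + degree q'"
        unfolding quadratic by (rule degree_mult_eq) (use q' in auto)
      moreover have "invertible_op (op_poly ?D T)"
      proof (rule coercive_invertible_op)
        show "complex_linear_op (op_poly ?D T)"
          by (intro selfadjoint_opD op_poly_selfadjoint T)
        show "v\<^sup>2 > 0"
          using quadratic by simp
        fix x
        \<comment> \<open>Completing the square: self-adjointness turns the form of
          \<open>(T - u)^2\<close> into a squared norm.\<close>
        have "op_poly ?D T x \<bullet> x - v\<^sup>2 * (x \<bullet> x) = (T x - u *\<^sub>R x) \<bullet> (T x - u *\<^sub>R x)"
          using selfadjoint_opD(2)[OF T, of "T x" x]
          by (simp add: blinfun.bilinear_simps inner_diff_left inner_diff_right inner_add_left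
              inner_commute[of x "T x"] power2_eq_square algebra_simps)
        moreover have "\<dots> \<ge> 0"
          by (rule inner_ge_zero)
        ultimately show "v\<^sup>2 * (x \<bullet> x) \<le> op_poly ?D T x \<bullet> x"
          by linarith
      qed
      moreover have "poly q' s \<noteq> 0" if "complex_of_real s \<in> op_spectrum T" for s
        using less.prems(1)[OF that] by (auto simp: quadratic)
      ultimately show ?thesis
        using less.hyps[of q'] q'
        by (simp add: quadratic op_poly_mult invertible_op_compose del: op_poly_pCons mult_pCons_left)
    qed
  qed
qed

lemma op_poly_nonneg:
  assumes T: "selfadjoint_op T"
    and q: "\<And>t. complex_of_real t \<in> op_spectrum T \<Longrightarrow> 0 \<le> poly q t"
  shows "0 \<le> op_poly q T x \<bullet> x"
proof (rule ccontr)
  assume "\<not> 0 \<le> op_poly q T x \<bullet> x"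
  then obtain m where m: "m < 0" "complex_of_real m \<in> op_spectrum (op_poly q T)"
    using negative_value_negative_spectrum[OF op_poly_selfadjoint[OF T]] by (metis not_le)
  have pos: "poly (q - [:m:]) t \<noteq> 0" if "complex_of_real t \<in> op_spectrum T" for t
    using q[OF that] m by simp
  have "op_poly (q - [:m:]) T = op_poly q T - m *\<^sub>R id_blinfun"
    by (simp only: op_poly_diff op_poly_const)
  then have ninv: "\<not> invertible_op (op_poly (q - [:m:]) T)"
    using m by (simp add: real_in_op_spectrum_iff)
  \<comment> \<open>Only the zero polynomial escapes \<open>op_poly_invertible\<close>; it
    contradicts \<open>pos\<close> at any point of the spectrum, and
    \<open>real_spectrum_nonempty\<close> supplies one.\<close>
  then have "q - [:m:] = 0"
    using op_poly_invertible[OF T pos] by auto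
  moreover have "x \<noteq> 0"
    using \<open>\<not> 0 \<le> op_poly q T x \<bullet> x\<close> by auto
  then obtain t where "complex_of_real t \<in> op_spectrum T"
    using real_spectrum_nonempty[OF T] by metis
  ultimately show False
    using pos by auto
qed


text \<open>The polynomial \<open>e^2 - q^2\<close> is nonnegative on the real spectrum, and its
  form at \<open>x\<close> is \<open>e^2\<close> times the squared norm of \<open>x\<close> minus
  the squared norm of \<open>q(T) x\<close>.\<close>

lemma norm_op_poly_le:
  assumes T: "selfadjoint_op T" and "0 \<le> e"
    and q: "\<And>t. complex_of_real t \<in> op_spectrum T \<Longrightarrow> \<bar>poly q t\<bar> \<le> e"
  shows "norm (op_poly q T) \<le> e"
proof (rule norm_blinfun_bound)
  fix x
  show "norm (op_poly q T x) \<le> e * norm x"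
  proof (rule power2_le_imp_le)
    have "0 \<le> poly ([:e\<^sup>2:] - q * q) t" if "complex_of_real t \<in> op_spectrum T" for t
      using abs_le_square_iff[of "poly q t" e] q[OF that] \<open>0 \<le> e\<close>
      by (simp add: power2_eq_square)
    then have "0 \<le> op_poly ([:e\<^sup>2:] - q * q) T x \<bullet> x"
      by (rule op_poly_nonneg[OF T])
    also have "\<dots> = e\<^sup>2 * (x \<bullet> x) - op_poly q T x \<bullet> op_poly q T x"
      unfolding op_poly_diff op_poly_const op_poly_mult
      using selfadjoint_opD(2)[OF op_poly_selfadjoint[OF T], of q "op_poly q T x" x]
      by (simp add: blinfun.bilinear_simps inner_diff_left)
    finally show "(norm (op_poly q T x))\<^sup>2 \<le> (e * norm x)\<^sup>2"
      by (simp add: power_mult_distrib power2_norm_eq_inner)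
  qed (use \<open>0 \<le> e\<close> in simp)
qed fact

section \<open>The functional calculus\<close>

lemma poly_uniform_approximation:
  fixes f :: "real \<Rightarrow> real"
  assumes "continuous_on {a..b} f"
  obtains P where "uniform_limit {a..b} (\<lambda>n. poly (P n)) f sequentially"
proof -
  obtain g where g: "uniform_limit {a..b} g f sequentially" "\<And>n. polynomial_function (g n)"
    using Stone_Weierstrass_uniform_limit[OF compact_Icc assms] by metis
  have "\<exists>p. g n = poly p" for n
  proof -
    obtain c N where "g n = (\<lambda>x. \<Sum>i\<le>N. c i * x ^ i)"
      using g(2)[of n] by (auto simp: real_polynomial_function_iff_sum
          simp flip: real_polynomial_function_eq)
    then have "g n = poly (\<Sum>i\<le>N. monom (c i) i)"
      by (auto simp: poly_sum poly_monom)
    then show ?thesis ..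
  qed
  then obtain P where "g = (\<lambda>n. poly (P n))"
    by metis
  with g(1) that show ?thesis
    by blast
qed

text \<open>The interval \<open>{a..b}\<close> encloses the real spectrum, so Weierstrass
  approximation can be done on an interval and then restricted to the spectrum.\<close>

locale bounded_selfadjoint_op =
  fixes T :: "'a::chilbert_space \<Rightarrow>\<^sub>L 'a" and a b :: real
  assumes lower: "a *\<^sub>R id_blinfun \<le>\<^sub>L T" and upper: "T \<le>\<^sub>L b *\<^sub>R id_blinfun"
begin

lemma selfadjoint: "selfadjoint_op T"
  using lower by (simp add: loewner_le_iff)

text \<open>For \<open>t\<close> outside the interval, \<open>T - t\<close> or \<open>t - T\<close>
  is coercive, with the distance to the nearer end as constant.\<close>

lemma spectrum_bounds:
  assumes "complex_of_real t \<in> op_spectrum T"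
  shows "t \<in> {a..b}"
proof (rule ccontr)
  assume "t \<notin> {a..b}"
  then consider "t < a" | "b < t"
    by fastforce
  then have "invertible_op (T - t *\<^sub>R id_blinfun)"
  proof cases
    case 1
    have "(a - t) * (x \<bullet> x) \<le> (T - t *\<^sub>R id_blinfun) x \<bullet> x" for x
      using lower by (simp add: loewner_le_iff blinfun.bilinear_simps inner_diff_left left_diff_distrib)
    with 1 show ?thesis
      by (intro coercive_invertible_op[of _ "a - t"])
        (auto intro!: complex_linear_op_intros selfadjoint_opD(1)[OF selfadjoint])
  next
    case 2
    have "(t - b) * (x \<bullet> x) \<le> (t *\<^sub>R id_blinfun - T) x \<bullet> x" for x
      using upper by (simp add: loewner_le_iff blinfun.bilinear_simps inner_diff_left left_diff_distrib)
    with 2 have "invertible_op (t *\<^sub>R id_blinfun - T)"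
      by (intro coercive_invertible_op[of _ "t - b"])
        (auto intro!: complex_linear_op_intros selfadjoint_opD(1)[OF selfadjoint])
    then show ?thesis
      using invertible_op_scaleR[of "t *\<^sub>R id_blinfun - T" "-1"] by simp
  qed
  with assms show False
    by (simp add: real_in_op_spectrum_iff)
qed

text \<open>The limit does not depend on the approximating sequence, which the definite description
  in \<open>fun_calc\<close> requires.\<close>

lemma op_poly_diff_tendsto_0:
  assumes P: "uniform_limit {t. complex_of_real t \<in> op_spectrum T} (\<lambda>n. poly (P n)) f sequentially"
    and Q: "uniform_limit {t. complex_of_real t \<in> op_spectrum T} (\<lambda>n. poly (Q n)) f sequentially"
  shows "(\<lambda>n. op_poly (P n) T - op_poly (Q n) T) \<longlonglongrightarrow> 0"
proof (rule tendstoI)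
  fix e :: real
  assume "e > 0"
  then have "e / 4 > 0"
    by simp
  from uniform_limitD[OF P this] uniform_limitD[OF Q this]
  show "\<forall>\<^sub>F n in sequentially. dist (op_poly (P n) T - op_poly (Q n) T) 0 < e"
  proof eventually_elim
    case (elim n)
    have "\<bar>poly (P n - Q n) t\<bar> \<le> e / 2" if "complex_of_real t \<in> op_spectrum T" for t
    proof -
      have "\<bar>poly (P n) t - f t\<bar> < e / 4" "\<bar>poly (Q n) t - f t\<bar> < e / 4"
        using elim that by (auto simp: dist_real_def)
      then show ?thesis
        unfolding poly_diff by linarith
    qed
    then have "norm (op_poly (P n - Q n) T) \<le> e / 2"
      using \<open>e > 0\<close> by (intro norm_op_poly_le selfadjoint) auto
    with \<open>e > 0\<close> show ?case
      by (simp add: op_poly_diff)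
  qed
qed

text \<open>One convergent sequence decides the value: every other sequence has the same limit, and
  any other candidate \<open>Y\<close> must be the limit along \<open>P\<close> as well.\<close>

lemma fun_calc_eqI:
  assumes P: "uniform_limit {a..b} (\<lambda>n. poly (P n)) f sequentially"
    and X: "(\<lambda>n. op_poly (P n) T) \<longlonglongrightarrow> X"
  shows "fun_calc f T = X"
proof -
  let ?S = "{t. complex_of_real t \<in> op_spectrum T}"
  have P': "uniform_limit ?S (\<lambda>n. poly (P n)) f sequentially"
    using P by (rule uniform_limit_on_subset) (use spectrum_bounds in auto)
  have "(\<lambda>n. op_poly (Q n) T) \<longlonglongrightarrow> X"
    if "uniform_limit ?S (\<lambda>n. poly (Q n)) f sequentially" for Q
    using tendsto_add[OF op_poly_diff_tendsto_0[OF that P'] X] by simp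
  then show ?thesis
    unfolding fun_calc_def
  proof (intro the_equality allI impI)
    fix Y
    assume "\<forall>Q. uniform_limit ?S (\<lambda>n. poly (Q n)) f sequentially \<longrightarrow> (\<lambda>n. op_poly (Q n) T) \<longlonglongrightarrow> Y"
    with P' X show "Y = X"
      using LIMSEQ_unique by blast
  qed
qed

text \<open>By \<open>norm_op_poly_le\<close>, uniformly close polynomials have operators close in
  norm, so Weierstrass approximants give a Cauchy sequence.\<close>

lemma fun_calc_approximation:
  assumes "continuous_on {a..b} f"
  obtains P where "uniform_limit {a..b} (\<lambda>n. poly (P n)) f sequentially"
    and "(\<lambda>n. op_poly (P n) T) \<longlonglongrightarrow> fun_calc f T"
proof -
  obtain P where P: "uniform_limit {a..b} (\<lambda>n. poly (P n)) f sequentially"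
    using poly_uniform_approximation[OF assms] .
  have "Cauchy (\<lambda>n. op_poly (P n) T)"
  proof (rule metric_CauchyI)
    fix e :: real
    assume "e > 0"
    then have "\<exists>M. \<forall>n\<ge>M. \<forall>t\<in>{a..b}. dist (poly (P n) t) (f t) < e / 4"
      using uniform_limitD[OF P, of "e / 4"] unfolding eventually_sequentially by simp
    then obtain M where M: "\<And>n t. n \<ge> M \<Longrightarrow> t \<in> {a..b} \<Longrightarrow> \<bar>poly (P n) t - f t\<bar> < e / 4"
      unfolding dist_real_def by blast
    have "dist (op_poly (P m) T) (op_poly (P n) T) < e" if "m \<ge> M" "n \<ge> M" for m n
    proof -
      have "\<bar>poly (P m - P n) t\<bar> \<le> e / 2" if "complex_of_real t \<in> op_spectrum T" for t
        unfolding poly_diff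
        using M[OF \<open>m \<ge> M\<close> spectrum_bounds[OF that]] M[OF \<open>n \<ge> M\<close> spectrum_bounds[OF that]]
        by linarith
      then have "norm (op_poly (P m - P n) T) \<le> e / 2"
        using \<open>e > 0\<close> by (intro norm_op_poly_le selfadjoint) auto
      with \<open>e > 0\<close> show ?thesis
        by (simp add: op_poly_diff dist_norm)
    qed
    then show "\<exists>M. \<forall>m\<ge>M. \<forall>n\<ge>M. dist (op_poly (P m) T) (op_poly (P n) T) < e"
      by blast
  qed
  then obtain X where "(\<lambda>n. op_poly (P n) T) \<longlonglongrightarrow> X"
    using Cauchy_convergent convergent_def by blast
  with P fun_calc_eqI[OF P] that show ?thesis
    by metis
qed

lemma fun_calc_poly:
  assumes "\<And>t. t \<in> {a..b} \<Longrightarrow> f t = poly q t"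
  shows "fun_calc f T = op_poly q T"
proof (rule fun_calc_eqI)
  show "uniform_limit {a..b} (\<lambda>n. poly q) f sequentially"
    using assms by (auto intro!: uniform_limitI)
qed simp

lemma fun_calc_mult:
  assumes f: "continuous_on {a..b} f" and g: "continuous_on {a..b} g"
  shows "fun_calc (\<lambda>t. f t * g t) T = fun_calc f T o\<^sub>L fun_calc g T"
proof -
  obtain P where P: "uniform_limit {a..b} (\<lambda>n. poly (P n)) f sequentially"
    "(\<lambda>n. op_poly (P n) T) \<longlonglongrightarrow> fun_calc f T"
    using fun_calc_approximation[OF f] .
  obtain Q where Q: "uniform_limit {a..b} (\<lambda>n. poly (Q n)) g sequentially"
    "(\<lambda>n. op_poly (Q n) T) \<longlonglongrightarrow> fun_calc g T"
    using fun_calc_approximation[OF g] .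
  show ?thesis
  proof (rule fun_calc_eqI)
    have "bounded (f ` {a..b})" "bounded (g ` {a..b})"
      using f g by (auto intro!: compact_imp_bounded compact_continuous_image)
    then show "uniform_limit {a..b} (\<lambda>n. poly (P n * Q n)) (\<lambda>t. f t * g t) sequentially"
      unfolding poly_mult by (intro uniform_lim_mult P Q)
    show "(\<lambda>n. op_poly (P n * Q n) T) \<longlonglongrightarrow> (fun_calc f T o\<^sub>L fun_calc g T)"
      unfolding op_poly_mult
      by (rule bounded_bilinear.tendsto[OF bounded_bilinear_blinfun_compose P(2) Q(2)])
  qed
qed

lemma fun_calc_scaleR:
  assumes "continuous_on {a..b} f"
  shows "fun_calc (\<lambda>t. c * f t) T = c *\<^sub>R fun_calc f T"
proof -
  have "fun_calc (\<lambda>_. c) T = c *\<^sub>R id_blinfun"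
    using fun_calc_poly[of "\<lambda>_. c" "[:c:]"] by (simp only: op_poly_const) simp
  then show ?thesis
    using fun_calc_mult[of "\<lambda>_. c" f] assms
    by (simp add: blinfun_eq_iff blinfun.bilinear_simps)
qed

lemma fun_calc_selfadjoint:
  assumes "continuous_on {a..b} f"
  shows "selfadjoint_op (fun_calc f T)"
proof -
  obtain P where P: "(\<lambda>n. op_poly (P n) T) \<longlonglongrightarrow> fun_calc f T"
    using fun_calc_approximation[OF assms] .
  have lim: "(\<lambda>n. op_poly (P n) T x) \<longlonglongrightarrow> fun_calc f T x" for x
    by (intro blinfun.tendsto P tendsto_const)
  have sa: "selfadjoint_op (op_poly (P n) T)" for n
    by (intro op_poly_selfadjoint selfadjoint)
  have sym: "fun_calc f T x \<bullet> y = x \<bullet> fun_calc f T y" for x y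
  proof (rule LIMSEQ_unique)
    show "(\<lambda>n. op_poly (P n) T x \<bullet> y) \<longlonglongrightarrow> fun_calc f T x \<bullet> y"
      by (intro tendsto_intros lim)
    show "(\<lambda>n. op_poly (P n) T x \<bullet> y) \<longlonglongrightarrow> x \<bullet> fun_calc f T y"
      unfolding selfadjoint_opD(2)[OF sa] by (intro tendsto_intros lim)
  qed
  have "fun_calc f T (c *\<^sub>C x) = c *\<^sub>C fun_calc f T x" for c x
  proof -
    have "fun_calc f T (c *\<^sub>C x) \<bullet> y = c *\<^sub>C fun_calc f T x \<bullet> y" for y
    proof (rule LIMSEQ_unique)
      show "(\<lambda>n. op_poly (P n) T (c *\<^sub>C x) \<bullet> y) \<longlonglongrightarrow> fun_calc f T (c *\<^sub>C x) \<bullet> y"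
        by (intro tendsto_intros lim)
      \<comment> \<open>With the scalar moved to the other argument, the limit uses only continuity
        of the inner product.\<close>
      have adj: "(c *\<^sub>C u) \<bullet> y = u \<bullet> (cnj c *\<^sub>C y)" for u
        by (simp add: inner_eq_Re_cinner cinner_scaleC_left cinner_scaleC_right)
      have "op_poly (P n) T (c *\<^sub>C x) \<bullet> y = op_poly (P n) T x \<bullet> (cnj c *\<^sub>C y)" for n
        using selfadjoint_opD(1)[OF sa] adj by (simp add: complex_linear_op_def)
      then show "(\<lambda>n. op_poly (P n) T (c *\<^sub>C x) \<bullet> y) \<longlonglongrightarrow> c *\<^sub>C fun_calc f T x \<bullet> y"
        unfolding adj by (simp only:) (intro tendsto_intros lim)
    qed
    then show ?thesis
      by (metis vector_eq_rdot)
  qed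
  with sym show ?thesis
    by (simp add: selfadjoint_op_iff complex_linear_op_def)
qed

lemma fun_calc_mono:
  assumes f: "continuous_on {a..b} f" and g: "continuous_on {a..b} g"
    and le: "\<And>t. t \<in> {a..b} \<Longrightarrow> f t \<le> g t"
  shows "fun_calc f T \<le>\<^sub>L fun_calc g T"
proof -
  obtain P where P: "uniform_limit {a..b} (\<lambda>n. poly (P n)) f sequentially"
    "(\<lambda>n. op_poly (P n) T) \<longlonglongrightarrow> fun_calc f T"
    using fun_calc_approximation[OF f] .
  obtain Q where Q: "uniform_limit {a..b} (\<lambda>n. poly (Q n)) g sequentially"
    "(\<lambda>n. op_poly (Q n) T) \<longlonglongrightarrow> fun_calc g T"
    using fun_calc_approximation[OF g] .
  have "fun_calc f T x \<bullet> x \<le> fun_calc g T x \<bullet> x" for x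
  proof -
    \<comment> \<open>Approximants of \<open>f\<close> and \<open>g\<close> are ordered only up to
      an error, so positivity is applied with slack \<open>e\<close>, which is removed at the
      end.\<close>
    have eps: "fun_calc f T x \<bullet> x \<le> fun_calc g T x \<bullet> x + e * (x \<bullet> x)" if "e > 0" for e
    proof (rule tendsto_le)
      show "(\<lambda>n. op_poly (P n) T x \<bullet> x) \<longlonglongrightarrow> fun_calc f T x \<bullet> x"
        by (intro tendsto_intros blinfun.tendsto P)
      show "(\<lambda>n. op_poly (Q n) T x \<bullet> x + e * (x \<bullet> x)) \<longlonglongrightarrow> fun_calc g T x \<bullet> x + e * (x \<bullet> x)"
        by (intro tendsto_intros blinfun.tendsto Q)
      have "e / 2 > 0"
        using that by simp
      from uniform_limitD[OF P(1) this] uniform_limitD[OF Q(1) this]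
      show "\<forall>\<^sub>F n in sequentially. op_poly (P n) T x \<bullet> x \<le> op_poly (Q n) T x \<bullet> x + e * (x \<bullet> x)"
      proof eventually_elim
        case (elim n)
        have "0 \<le> op_poly (Q n + [:e:] - P n) T x \<bullet> x"
        proof (rule op_poly_nonneg[OF selfadjoint])
          fix t
          assume "complex_of_real t \<in> op_spectrum T"
          then have t: "t \<in> {a..b}"
            by (rule spectrum_bounds)
          then have "\<bar>poly (P n) t - f t\<bar> < e / 2" "\<bar>poly (Q n) t - g t\<bar> < e / 2"
            using elim by (auto simp: dist_real_def)
          with le[OF t] have "poly (P n) t \<le> poly (Q n) t + e"
            by linarith
          then show "0 \<le> poly (Q n + [:e:] - P n) t"
            by simp
        qed
        then show ?case
          unfolding op_poly_diff op_poly_add op_poly_const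
          by (simp add: blinfun.bilinear_simps inner_diff_left inner_add_left)
      qed
    qed simp
    show ?thesis
    proof (cases "x = 0")
      case False
      show ?thesis
      proof (rule field_le_epsilon)
        fix e :: real
        assume "e > 0"
        with False eps[of "e / (x \<bullet> x)"] show "fun_calc f T x \<bullet> x \<le> fun_calc g T x \<bullet> x + e"
          by simp
      qed
    qed simp
  qed
  then show ?thesis
    by (simp add: loewner_le_iff fun_calc_selfadjoint f g)
qed

end

section \<open>The scalar inequality\<close>

text \<open>Since \<open>K(t)\<close> is the squared arithmetic mean of 1 and \<open>t\<close>
  divided by \<open>t\<close>, its powers split into the factors that occur in Young's
  inequality.\<close>

lemma kantorovich_powr:
  assumes "t > 0"
  shows "kantorovich t powr s = ((1 + t) / 2) powr (2 * s) * t powr - s"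
proof -
  have "kantorovich t = ((1 + t) / 2) powr 2 * t powr - 1"
    using assms by (simp add: kantorovich_def powr_minus field_simps power2_eq_square)
  then have "kantorovich t powr s = (((1 + t) / 2) powr 2) powr s * (t powr - 1) powr s"
    using assms by (simp only: powr_mult powr_ge_zero)
  then show ?thesis
    by (simp only: powr_powr) simp
qed

text \<open>For \<open>p \<le> 1 / 2\<close>, the right side is the convex combination of
  \<open>(1 + t) / 2\<close> and \<open>1\<close> with weights \<open>2 * p\<close> and
  \<open>1 - 2 * p\<close>; for larger \<open>p\<close>, \<open>t\<close> takes the place of
  \<open>1\<close>. Young's inequality applies to it.\<close>

lemma weighted_mean_lower:
  fixes t p :: real
  assumes t: "t > 0" and p: "0 \<le> p" "p \<le> 1"
  shows "kantorovich t powr (min p (1 - p)) * t powr p \<le> 1 - p + p * t"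
proof (cases "p \<le> 1 / 2")
  case True
  then have "kantorovich t powr (min p (1 - p)) * t powr p = ((1 + t) / 2) powr (2 * p) * 1 powr (1 - 2 * p)"
    using t by (simp add: kantorovich_powr powr_minus min_def)
  also have "\<dots> \<le> 2 * p * ((1 + t) / 2) + (1 - 2 * p) * 1"
    using True t p by (intro Youngs_inequality_0) auto
  finally show ?thesis
    by (simp add: field_simps)
next
  case False
  then have "kantorovich t powr (min p (1 - p)) * t powr p
      = ((1 + t) / 2) powr (2 * (1 - p)) * t powr (2 * p - 1)"
    using t by (simp add: kantorovich_powr min_def flip: powr_add)
  also have "\<dots> \<le> 2 * (1 - p) * ((1 + t) / 2) + (2 * p - 1) * t"
    using False t p by (intro Youngs_inequality_0) auto
  finally show ?thesis
    by (simp add: field_simps)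
qed

lemma weighted_mean_upper:
  fixes t p :: real
  assumes t: "t > 0" and p: "0 \<le> p" "p \<le> 1"
  shows "1 - p + p * t \<le> kantorovich t powr (max p (1 - p)) * t powr p"
proof -
  define R where "R = max p (1 - p)"
  define m where "m = 1 - p + p * t"
  have R: "R \<ge> 1 / 2"
    by (simp add: R_def max_def)
  have m: "m > 0"
    using t p by (cases "p = 0") (auto simp: m_def add_nonneg_pos)
  text \<open>Young's inequality for \<open>m\<close> with weight \<open>1 / (2 R)\<close> against \<open>1\<close> or \<open>t\<close>,
    whichever carries the smaller weight in \<open>m\<close>.\<close>
  have "m powr (1 / (2 * R)) * t powr ((R - p) / (2 * R)) \<le> (1 + t) / 2"
  proof (cases "p \<le> 1 / 2")
    case True
    then have [simp]: "R = 1 - p"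
      by (simp add: R_def)
    have "m powr (1 / (2 * R)) * t powr ((R - p) / (2 * R))
        \<le> 1 / (2 * R) * m + (R - p) / (2 * R) * t"
      using True t p m by (intro Youngs_inequality_0) (auto simp: field_simps)
    also have "\<dots> = (m + (R - p) * t) / (2 * R)"
      by (simp only: add_divide_distrib) simp
    also have "m + (R - p) * t = R * (1 + t)"
      by (simp add: m_def algebra_simps)
    also have "R * (1 + t) / (2 * R) = (1 + t) / 2"
      using R by (simp add: field_simps del: \<open>R = 1 - p\<close>)
    finally show ?thesis .
  next
    case False
    then have [simp]: "R = p"
      by (simp add: R_def)
    have "m powr (1 / (2 * R)) * 1 powr ((2 * p - 1) / (2 * R))
        \<le> 1 / (2 * R) * m + (2 * p - 1) / (2 * R) * 1"
      using False t p m by (intro Youngs_inequality_0) (auto simp: field_simps)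
    also have "\<dots> = (1 + t) / 2"
      using False by (simp add: m_def field_simps)
    finally show ?thesis
      using t by simp
  qed
  \<comment> \<open>The power \<open>2 * R\<close> frees \<open>m\<close> of its exponent; the
    factor \<open>t powr (p - R)\<close> then completes the Kantorovich term.\<close>
  then have "(m powr (1 / (2 * R)) * t powr ((R - p) / (2 * R))) powr (2 * R)
      \<le> ((1 + t) / 2) powr (2 * R)"
    using R by (intro powr_mono2) auto
  then have "m * t powr (R - p) \<le> ((1 + t) / 2) powr (2 * R)"
    using R t m by (simp add: powr_mult powr_powr)
  then have "m * t powr (R - p) * t powr (p - R) \<le> ((1 + t) / 2) powr (2 * R) * t powr (p - R)"
    by (intro mult_right_mono) auto
  then have "m \<le> ((1 + t) / 2) powr (2 * R) * t powr (p - R)"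
    using t by (simp add: mult.assoc flip: powr_add)
  also have "\<dots> = kantorovich t powr R * t powr p"
    using t by (simp add: kantorovich_powr mult.assoc flip: powr_add)
  finally show ?thesis
    by (simp add: m_def R_def)
qed

lemma kantorovich_pos: "t > 0 \<Longrightarrow> kantorovich t > 0"
  by (simp add: kantorovich_def add_pos_pos)

text \<open>The factor \<open>s * t - 1\<close> fixes the sign: it is nonnegative when both
  arguments are at least 1 and nonpositive when both are at most 1.\<close>

lemma kantorovich_diff:
  assumes "s > 0" "t > 0"
  shows "kantorovich t - kantorovich s = (t - s) * (s * t - 1) / (4 * s * t)"
  using assms by (simp add: kantorovich_def field_simps power2_eq_square)

lemma kantorovich_mono:
  assumes "1 \<le> s" "s \<le> t"
  shows "kantorovich s \<le> kantorovich t"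
proof -
  have "1 * 1 \<le> s * t"
    using assms by (intro mult_mono) auto
  then have "0 \<le> (t - s) * (s * t - 1) / (4 * s * t)"
    using assms by simp
  then show ?thesis
    using kantorovich_diff[of s t] assms by simp
qed

lemma kantorovich_antimono:
  assumes "0 < s" "s \<le> t" "t \<le> 1"
  shows "kantorovich t \<le> kantorovich s"
proof -
  have "s * t \<le> 1 * 1"
    using assms by (intro mult_mono) auto
  then have "(t - s) * (s * t - 1) / (4 * s * t) \<le> 0"
    using assms by (intro divide_nonpos_nonneg mult_nonneg_nonpos) auto
  then show ?thesis
    using kantorovich_diff[of s t] assms by simp
qed

section \<open>The operator inequality\<close>

text \<open>Arbitrary bounds \<open>k\<close> and \<open>K\<close> for \<open>kantorovich\<close> on
  the interval serve both cases of the theorem, where the roles of the endpoints are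
  exchanged.\<close>

lemma weighted_means_of_bounded_op:
  fixes C :: "'a::chilbert_space \<Rightarrow>\<^sub>L 'a"
  assumes C: "a *\<^sub>R id_blinfun \<le>\<^sub>L C" "C \<le>\<^sub>L b *\<^sub>R id_blinfun" and a: "0 < a"
    and p: "0 \<le> p" "p \<le> 1"
    and k: "\<And>t. t \<in> {a..b} \<Longrightarrow> 0 \<le> k \<and> k \<le> kantorovich t \<and> kantorovich t \<le> K"
  shows "(k powr min p (1 - p)) *\<^sub>R op_powr C p \<le>\<^sub>L (1 - p) *\<^sub>R id_blinfun + p *\<^sub>R C"
    and "(1 - p) *\<^sub>R id_blinfun + p *\<^sub>R C \<le>\<^sub>L (K powr max p (1 - p)) *\<^sub>R op_powr C p"
proof -
  interpret bounded_selfadjoint_op C a b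
    using C by unfold_locales
  have cont: "continuous_on {a..b} (\<lambda>t. t powr p)"
    using a by (intro continuous_intros) auto
  have "(1 - p) *\<^sub>R id_blinfun + p *\<^sub>R C = op_poly [:1 - p, p:] C"
    by (simp add: blinfun_eq_iff blinfun.bilinear_simps)
  also have "\<dots> = fun_calc (\<lambda>t. 1 - p + p * t) C"
    by (rule fun_calc_poly[symmetric]) simp
  finally have mean: "(1 - p) *\<^sub>R id_blinfun + p *\<^sub>R C = fun_calc (\<lambda>t. 1 - p + p * t) C" .
  have powr: "c *\<^sub>R op_powr C p = fun_calc (\<lambda>t. c * t powr p) C" for c
    by (simp add: op_powr_def fun_calc_scaleR cont)
  show "(k powr min p (1 - p)) *\<^sub>R op_powr C p \<le>\<^sub>L (1 - p) *\<^sub>R id_blinfun + p *\<^sub>R C"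
    unfolding mean powr
  proof (rule fun_calc_mono)
    fix t
    assume t: "t \<in> {a..b}"
    have "k powr min p (1 - p) * t powr p \<le> kantorovich t powr min p (1 - p) * t powr p"
      using k[OF t] p by (intro mult_right_mono powr_mono2) auto
    also have "\<dots> \<le> 1 - p + p * t"
      using t a p by (intro weighted_mean_lower) auto
    finally show "k powr min p (1 - p) * t powr p \<le> 1 - p + p * t" .
  qed (intro continuous_intros cont)+
  show "(1 - p) *\<^sub>R id_blinfun + p *\<^sub>R C \<le>\<^sub>L (K powr max p (1 - p)) *\<^sub>R op_powr C p"
    unfolding mean powr
  proof (rule fun_calc_mono)
    fix t
    assume t: "t \<in> {a..b}"
    have "1 - p + p * t \<le> kantorovich t powr max p (1 - p) * t powr p"
      using t a p by (intro weighted_mean_upper) auto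
    also have "\<dots> \<le> K powr max p (1 - p) * t powr p"
      using k[OF t] p by (intro mult_right_mono powr_mono2) auto
    finally show "1 - p + p * t \<le> K powr max p (1 - p) * t powr p" .
  qed (intro continuous_intros cont)+
qed

text \<open>Coercivity keeps the spectrum away from 0, so all powers are continuous on
  \<open>{a..norm A}\<close>. A product of powers becomes a polynomial when the exponents add up to
  1 or 0.\<close>

lemma op_powr_half:
  fixes A :: "'a::chilbert_space \<Rightarrow>\<^sub>L 'a"
  assumes "positive_op A" "invertible_op A"
  shows "selfadjoint_op (op_powr A (1/2))"
    and "op_powr A (1/2) o\<^sub>L op_powr A (1/2) = A"
    and "op_powr A (1/2) o\<^sub>L op_powr A (-1/2) = id_blinfun"
    and "op_powr A (-1/2) o\<^sub>L op_powr A (1/2) = id_blinfun"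
proof -
  obtain a where a: "a > 0" "\<And>x. a * (x \<bullet> x) \<le> A x \<bullet> x"
    using positive_invertible_coercive[OF assms] by blast
  have sa: "selfadjoint_op A"
    using assms by (simp add: positive_op_iff)
  have "A x \<bullet> x \<le> norm A * (x \<bullet> x)" for x
    using inner_blinfun_le[of A x] by linarith
  then interpret bounded_selfadjoint_op A a "norm A"
    using a sa by unfold_locales
      (auto simp: loewner_le_iff selfadjoint_op_intros blinfun.bilinear_simps)
  have cont: "continuous_on {a..norm A} (\<lambda>t. t powr s)" for s
    using a by (intro continuous_intros) auto
  have mult: "op_powr A s o\<^sub>L op_powr A s' = op_poly q A"
    if "\<And>t. t > 0 \<Longrightarrow> t powr (s + s') = poly q t" for s s' q
    unfolding op_powr_def
    using fun_calc_mult[OF cont cont] fun_calc_poly[of "\<lambda>t. t powr s * t powr s'" q] that a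
    by (simp add: powr_add)
  show "selfadjoint_op (op_powr A (1/2))"
    unfolding op_powr_def by (intro fun_calc_selfadjoint cont)
  show "op_powr A (1/2) o\<^sub>L op_powr A (1/2) = A"
    using mult[of "1/2" "1/2" "[:0, 1:]"] by (simp only: op_poly_X) simp
  show "op_powr A (1/2) o\<^sub>L op_powr A (-1/2) = id_blinfun"
    using mult[of "1/2" "-1/2" "[:1:]"] by (simp only: op_poly_const) simp
  show "op_powr A (-1/2) o\<^sub>L op_powr A (1/2) = id_blinfun"
    using mult[of "-1/2" "1/2" "[:1:]"] by (simp only: op_poly_const) simp
qed

theorem proposition2:
  fixes A B :: "'a::chilbert_space \<Rightarrow>\<^sub>L 'a"
    and h h' p r R :: real
  defines "C \<equiv> op_powr A (-1/2) o\<^sub>L B o\<^sub>L op_powr A (-1/2)"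
  assumes "positive_op A" and "invertible_op A"
    and "positive_op B" and "invertible_op B"
    and "(1 < h' \<and> h' *\<^sub>R id_blinfun \<le>\<^sub>L C \<and> C \<le>\<^sub>L h *\<^sub>R id_blinfun)
       \<or> (0 < h \<and> h *\<^sub>R id_blinfun \<le>\<^sub>L C \<and> C \<le>\<^sub>L h' *\<^sub>R id_blinfun \<and> h' < 1)"
    and "0 \<le> p" and "p \<le> 1"
    and "r = min p (1 - p)" and "R = max p (1 - p)"
  shows "(kantorovich h' powr r) *\<^sub>R geom_mean p A B \<le>\<^sub>L arith_mean p A B
       \<and> arith_mean p A B \<le>\<^sub>L (kantorovich h powr R) *\<^sub>R geom_mean p A B"
proof -
  let ?S = "op_powr A (1/2)"
  note S = op_powr_half[OF \<open>positive_op A\<close> \<open>invertible_op A\<close>]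
  \<comment> \<open>The exponent is written \<open>- (1/2)\<close>, the form that simplification
    gives to \<open>-1/2\<close>.\<close>
  have SS: "?S (?S x) = A x" and inv: "?S (op_powr A (- (1/2)) x) = x" "op_powr A (- (1/2)) (?S x) = x" for x
    using S(2-4) by (simp_all add: blinfun_eq_iff)
  have geom: "c *\<^sub>R geom_mean p A B = ?S o\<^sub>L (c *\<^sub>R op_powr C p) o\<^sub>L ?S" for c
    by (simp add: geom_mean_def C_def blinfun_eq_iff blinfun.bilinear_simps)
  \<comment> \<open>Conjugation by \<open>?S\<close> sends the identity to \<open>A\<close>, and
    \<open>C\<close> to \<open>B\<close> because the half powers cancel.\<close>
  have arith: "arith_mean p A B = ?S o\<^sub>L ((1 - p) *\<^sub>R id_blinfun + p *\<^sub>R C) o\<^sub>L ?S"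
    by (simp add: arith_mean_def C_def blinfun_eq_iff blinfun.bilinear_simps SS inv)
  \<comment> \<open>As \<open>kantorovich\<close> grows away from 1 on either side, on
    \<open>{h'..h}\<close> respectively \<open>{h..h'}\<close> it stays between its values at
    \<open>h'\<close> and at \<open>h\<close>.\<close>
  have "(kantorovich h' powr r) *\<^sub>R op_powr C p \<le>\<^sub>L (1 - p) *\<^sub>R id_blinfun + p *\<^sub>R C
      \<and> (1 - p) *\<^sub>R id_blinfun + p *\<^sub>R C \<le>\<^sub>L (kantorovich h powr R) *\<^sub>R op_powr C p"
    using assms(6)
  proof
    assume *: "1 < h' \<and> h' *\<^sub>R id_blinfun \<le>\<^sub>L C \<and> C \<le>\<^sub>L h *\<^sub>R id_blinfun"
    have "0 \<le> kantorovich h' \<and> kantorovich h' \<le> kantorovich t \<and> kantorovich t \<le> kantorovich h"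
      if "t \<in> {h'..h}" for t
      using that * kantorovich_pos[of h'] by (auto intro!: kantorovich_mono)
    then show ?thesis
      unfolding assms(9,10)
      using weighted_means_of_bounded_op[of h' C h p "kantorovich h'" "kantorovich h"] * assms(7,8)
      by auto
  next
    assume *: "0 < h \<and> h *\<^sub>R id_blinfun \<le>\<^sub>L C \<and> C \<le>\<^sub>L h' *\<^sub>R id_blinfun \<and> h' < 1"
    have "0 \<le> kantorovich h' \<and> kantorovich h' \<le> kantorovich t \<and> kantorovich t \<le> kantorovich h"
      if "t \<in> {h..h'}" for t
      using that * kantorovich_pos[of h'] by (auto intro!: kantorovich_antimono)
    then show ?thesis
      unfolding assms(9,10)
      using weighted_means_of_bounded_op[of h C h' p "kantorovich h'" "kantorovich h"] * assms(7,8)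
      by auto
  qed
  then show ?thesis
    unfolding geom arith using S(1) by (auto intro: loewner_le_conjugate)
qed

end
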